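(* (i) For all integers $n,d$ with $3<d<n-1$, set $q(e)=\left\lfloor\frac{e(n+1-d)-2}{n-2}\right\rfloor+1$. There are at least $\frac{n+1-d}{2}$ ray congruence classes (arithmetic progressions) mod $d(n-2)$ of $e$ which are both accessible and point-minimal. (ii) For such $n,d$, the set of values $q(e)$ with $e$ accessible and point-minimal contains $(n+1-d)/2$ many ray congruence classes mod $(n+1-d)d$. (iii) If integers $n,d$ with $3<d<n-1$ are such that $$\gcd\big((n+1)(n-2),\,n+1-d\big)=1,$$ then there are at least $f(n,d)$ ray congruence classes mod $d(n-2)$ (respectively, mod $d(n+1-d)$) of accessible and point-minimal $e$ (respectively, of values $q(e)$ over those $e$), where $$f(n,d)=\min\left\{\frac{(n-d)(n-d-1)}{2}-2,\ \frac{(d+1)(d-6)}{2},\ \frac{(n-d+1)(n-d-2)}{2}-3\right\}.$$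
   Context: An integer $e$ is accessible if for some integer $e_0$ with $d-1\leq e_0\leq e$ one has $\left\lfloor\frac{-de_0+e}{n-d}\right\rfloor+e=e_0+\left\lfloor\frac{2e_0-2}{d-2}\right\rfloor$. An integer $e$ is point-minimal if $q(e-1)<q(e)$. A ray congruence class mod $N$ is the intersection of a congruence class mod $N$ with a ray $[M,\infty)$, i.e. an infinite increasing arithmetic progression with modulus $N$. In (ii), "$(n+1-d)/2$ many" means at least that many. *)

theory Defs
  imports Complex_Main "HOL-Number_Theory.Cong"
begin

definition accessible :: "int \<Rightarrow> int \<Rightarrow> int \<Rightarrow> bool" where
  "accessible n d e \<longleftrightarrow> (\<exists>e0::int. d - 1 \<le> e0 \<and> e0 \<le> e \<and>
     \<lfloor>real_of_int (- d * e0 + e) / real_of_int (n - d)\<rfloor> + e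
       = e0 + \<lfloor>real_of_int (2 * e0 - 2) / real_of_int (d - 2)\<rfloor>)"

definition q :: "int \<Rightarrow> int \<Rightarrow> int \<Rightarrow> int" where
  "q n d e = \<lfloor>real_of_int (e * (n + 1 - d) - 2) / real_of_int (n - 2)\<rfloor> + 1"

definition point_minimal :: "int \<Rightarrow> int \<Rightarrow> int \<Rightarrow> bool" where
  "point_minimal n d e \<longleftrightarrow> q n d (e - 1) < q n d e"

definition ray_congruence_class :: "int \<Rightarrow> int set \<Rightarrow> bool" where
  "ray_congruence_class N R \<longleftrightarrow> (\<exists>a M. R = {x. [x = a] (mod N)} \<inter> {M..})"

(* S contains at least r ray congruence classes mod N.  They are counted up to
   the choice of the starting point: shifting M would produce infinitely many
   nested rays with the same residue, so the rays are required to be pairwise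
   disjoint, i.e. to have pairwise distinct residues mod N. The bound r is real as it
   may be a half-integer or negative. *)
definition contains_ray_classes :: "int set \<Rightarrow> int \<Rightarrow> real \<Rightarrow> bool" where
  "contains_ray_classes S N r \<longleftrightarrow> (\<exists>F. finite F \<and> pairwise disjnt F \<and>
     (\<forall>R\<in>F. ray_congruence_class N R \<and> R \<subseteq> S) \<and> r \<le> real (card F))"

definition f :: "int \<Rightarrow> int \<Rightarrow> real" where
  "f n d = Min {real_of_int ((n - d) * (n - d - 1)) / 2 - 2,
                real_of_int ((d + 1) * (d - 6)) / 2,
                real_of_int ((n - d + 1) * (n - d - 2)) / 2 - 3}"

end

theory Submission
  imports Defs
begin

text \<open>
  Write \<open>m = n + 1 - d\<close>. Point-minimal \<open>e\<close> are in bijection with the integers \<open>t = q(e) - 1\<close>: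
  the point belonging to \<open>t\<close> is the ceiling of \<open>(t (n-2) + 2) / m\<close>, so that
  \<open>m e = t (n-2) + 2 + r\<close>, where \<open>r \<in> [0, m)\<close> is the residue of \<open>-2 - t (d-3)\<close> mod \<open>m\<close>.

  The equation defining accessibility reads
  \<open>\<lfloor>(m e - d e\<^sub>0) / (m-1)\<rfloor> = \<lfloor>(d e\<^sub>0 - 2) / (d-2)\<rfloor>\<close>. If both sides equal \<open>t'\<close>, with remainders
  \<open>a < m - 1\<close> and \<open>b < d - 2\<close>, then adding up gives \<open>m e - 2 = t' (n-2) + a + b\<close>, which forces
  \<open>t' = t\<close> and \<open>a + b = r\<close>. As \<open>d e\<^sub>0 = t (d-2) + 2 + b\<close>, a suitable \<open>e\<^sub>0\<close> exists as soon as \<open>b\<close> is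
  congruent to \<open>2 (t-1)\<close> mod \<open>d\<close>. The side conditions \<open>d - 1 \<le> e\<^sub>0 \<le> e\<close> hold once \<open>t\<close> is large.
  Hence accessibility of large points depends only on \<open>t\<close> mod \<open>d m\<close> (\<open>accessible_level\<close>,
  \<open>accessible_minimal_point\<close>), and classes of levels \<open>t\<close> mod \<open>d m\<close> correspond to classes of values
  \<open>q(e) = t + 1\<close> mod \<open>d m\<close> and to classes of \<open>e\<close> mod \<open>d (n-2)\<close> (\<open>ray_classes_from_levels\<close>). It
  remains to count residues of \<open>t\<close>.

  For (i) and (ii), take \<open>t = 1 + d i\<close> and \<open>b = 0\<close>; this fails only if \<open>r = m - 1\<close>, and that
  cannot happen for two cyclically consecutive \<open>i\<close>, so it happens for at most half of the
  residues \<open>i\<close> mod \<open>m\<close>. For (iii), the coprimality hypothesis makes \<open>t\<close> mod \<open>d\<close> and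
  \<open>r\<close> independent by the Chinese remainder theorem, and a triangle of pairs
  \<open>0 \<le> j \<le> r < min (m-1) (d-2)\<close> gives enough admissible combinations.
\<close>

section \<open>Counting ray classes\<close>

lemma contains_ray_classesI:
  fixes g :: "'a \<Rightarrow> int"
  assumes "finite I" and "N > 0"
    and inc: "\<And>i j. i \<in> I \<Longrightarrow> j \<in> I \<Longrightarrow> [g i = g j] (mod N) \<Longrightarrow> i = j"
    and sub: "\<And>i x. i \<in> I \<Longrightarrow> [x = g i] (mod N) \<Longrightarrow> B \<le> x \<Longrightarrow> x \<in> S"
    and "c \<le> real (card I)"
  shows "contains_ray_classes S N c"
proof -
  define R where "R i = {x. [x = g i] (mod N)} \<inter> {B..}" for i
  have dis: "disjnt (R i) (R j)" if "i \<in> I" "j \<in> I" "i \<noteq> j" for i j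
    using inc[OF that(1,2)] that(3) by (auto simp: disjnt_iff R_def cong_def)
  have ne: "R i \<noteq> {}" for i
  proof -
    have "B + (g i - B) mod N \<in> R i"
      using \<open>N > 0\<close> by (auto simp: R_def cong_def mod_add_right_eq)
    then show ?thesis by blast
  qed
  have inj: "inj_on R I"
    using dis ne by (metis disjnt_self_iff_empty inj_onI)
  have "finite (R ` I)" "c \<le> real (card (R ` I))"
    using assms(1,5) inj by (auto simp: card_image)
  moreover have "pairwise disjnt (R ` I)"
    using dis by (auto simp: pairwise_def)
  moreover have "ray_congruence_class N (R i) \<and> R i \<subseteq> S" if "i \<in> I" for i
    using sub[OF that] by (auto simp: ray_congruence_class_def R_def)
  ultimately show ?thesis
    unfolding contains_ray_classes_def by blast
qed

section \<open>Points and levels\<close>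

definition excess :: "int \<Rightarrow> int \<Rightarrow> int \<Rightarrow> int" where
  "excess n d t = (- 2 - t * (d - 3)) mod (n + 1 - d)"

text \<open>The least \<open>e\<close> with \<open>q(e) = t + 1\<close>.\<close>
definition minimal_point :: "int \<Rightarrow> int \<Rightarrow> int \<Rightarrow> int" where
  "minimal_point n d t = (t * (n - 2) + 2 + excess n d t) div (n + 1 - d)"

text \<open>The number \<open>b\<close> is the remainder of \<open>d e\<^sub>0 - 2\<close> mod \<open>d - 2\<close>, and \<open>excess n d t - b\<close>
  that of \<open>m e - d e\<^sub>0\<close> mod \<open>m - 1\<close>, for \<open>m = n + 1 - d\<close>.\<close>
definition accessible_level :: "int \<Rightarrow> int \<Rightarrow> int \<Rightarrow> bool" where
  "accessible_level n d t \<longleftrightarrow>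
     (\<exists>b. 0 \<le> b \<and> b \<le> d - 3 \<and> b \<le> excess n d t \<and> excess n d t - b < n - d \<and>
        d dvd b - 2 * (t - 1))"

lemma minimal_point_mult:
  "(n + 1 - d) * minimal_point n d t = t * (n - 2) + 2 + excess n d t"
proof -
  have "[t * (n - 2) + 2 + excess n d t = t * (n - 2) + 2 + (- 2 - t * (d - 3))] (mod (n + 1 - d))"
    unfolding excess_def cong_def by (simp only: mod_add_right_eq)
  also have "t * (n - 2) + 2 + (- 2 - t * (d - 3)) = (n + 1 - d) * t"
    by (simp add: algebra_simps)
  finally have "(n + 1 - d) dvd t * (n - 2) + 2 + excess n d t"
    by (simp add: cong_def mod_eq_0_iff_dvd)
  then show ?thesis
    by (simp add: minimal_point_def)
qed

lemma excess_add: "excess n d (t + d * (n + 1 - d) * k) = excess n d t"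
proof -
  have "- 2 - (t + d * (n + 1 - d) * k) * (d - 3)
      = (- 2 - t * (d - 3)) + (n + 1 - d) * (- (d * k * (d - 3)))"
    by (simp add: algebra_simps)
  then show ?thesis
    unfolding excess_def by (simp only: mod_mult_self2)
qed

lemma minimal_point_add:
  assumes "d < n - 1"
  shows "minimal_point n d (t + d * (n + 1 - d) * k) = minimal_point n d t + d * (n - 2) * k"
proof -
  have "(n + 1 - d) * minimal_point n d (t + d * (n + 1 - d) * k)
      = (n + 1 - d) * (minimal_point n d t + d * (n - 2) * k)"
    unfolding distrib_left minimal_point_mult excess_add by (simp add: algebra_simps)
  then show ?thesis using assms by simp
qed

lemma accessible_level_cong:
  assumes "[t = t'] (mod d * (n + 1 - d))" and "accessible_level n d t"
  shows "accessible_level n d t'"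
proof -
  obtain k where t': "t' = t + d * (n + 1 - d) * k"
    using assms(1) by (metis cong_iff_lin)
  have "b - 2 * (t' - 1) = (b - 2 * (t - 1)) - d * (2 * (n + 1 - d) * k)" for b
    unfolding t' by (simp add: algebra_simps)
  then have "d dvd b - 2 * (t' - 1)" if "d dvd b - 2 * (t - 1)" for b
    using that by (metis dvd_diff dvd_triv_left)
  moreover have "excess n d t' = excess n d t"
    unfolding t' by (rule excess_add)
  ultimately show ?thesis
    using assms(2) unfolding accessible_level_def by metis
qed

lemma floor_divide_eqI:
  assumes "0 < c" and "c * k \<le> a" and "a < c * k + c"
  shows "\<lfloor>real_of_int a / real_of_int c\<rfloor> = k"
proof -
  have "a div c = k"
    using assms by (intro int_div_pos_eq[where r = "a - c * k"]) auto
  then show ?thesis by (simp add: floor_divide_of_int_eq)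
qed

context
  fixes n d :: int
  assumes d: "3 < d" and dn: "d < n - 1"
begin

lemma excess_bounds: "0 \<le> excess n d t" "excess n d t \<le> n - d"
proof -
  have "excess n d t < n + 1 - d"
    unfolding excess_def using dn by (intro pos_mod_bound) simp
  then show "excess n d t \<le> n - d" by simp
qed (use dn in \<open>simp add: excess_def\<close>)

lemma q_minimal_point: "q n d (minimal_point n d t) = t + 1"
proof -
  have "minimal_point n d t * (n + 1 - d) - 2 = (n - 2) * t + excess n d t"
    using minimal_point_mult[of n d t] by (simp add: algebra_simps)
  then show ?thesis
    unfolding q_def using excess_bounds[of t] d dn
    by (subst floor_divide_eqI[where k = t]) auto
qed

lemma point_minimal_minimal_point: "point_minimal n d (minimal_point n d t)"
proof -
  have "(minimal_point n d t - 1) * (n + 1 - d) - 2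
      = (n - 2) * (t - 1) + (excess n d t + (n - 2) - (n + 1 - d))"
    using minimal_point_mult[of n d t] by (simp add: algebra_simps)
  then have "q n d (minimal_point n d t - 1) = t"
    unfolding q_def using excess_bounds[of t] d dn
    by (subst floor_divide_eqI[where k = "t - 1"]) auto
  then show ?thesis
    by (simp add: point_minimal_def q_minimal_point)
qed

text \<open>This holds because \<open>q\<close> is monotone and undoes \<open>minimal_point n d\<close> up to a shift by 1.\<close>
lemma minimal_point_le_iff: "minimal_point n d s \<le> minimal_point n d t \<longleftrightarrow> s \<le> t"
proof -
  have mono: "q n d x \<le> q n d y" if "x \<le> y" for x y
    unfolding q_def using that d dn
    by (auto intro!: floor_mono divide_right_mono)
  have "minimal_point n d s \<le> minimal_point n d t" if "s < t"
  proof (rule ccontr)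
    assume "\<not> ?thesis"
    then have "q n d (minimal_point n d t) \<le> q n d (minimal_point n d s)"
      using mono by simp
    with that show False by (simp add: q_minimal_point)
  qed
  then show ?thesis
    using mono[of "minimal_point n d s" "minimal_point n d t"] q_minimal_point
    by (cases "s = t") force+
qed

text \<open>Dividing \<open>d e\<^sub>0 = t (d-2) + 2 + b\<close> and \<open>m e = t (n-2) + 2 + r\<close> shows that \<open>e\<^sub>0\<close> grows
  like \<open>t (d-2) / d\<close> and \<open>e\<close> like \<open>t (n-2) / m\<close>. The first slope is below 1 and the second
  above it, so \<open>t\<close> itself separates \<open>e\<^sub>0\<close> from \<open>e\<close>; the lower bound on \<open>t\<close>, which is far
  from sharp, secures \<open>d - 1 \<le> e\<^sub>0 \<le> t\<close>.\<close>
lemma accessible_minimal_point: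
  assumes "accessible_level n d t" and large: "d * d + n \<le> t"
  shows "accessible n d (minimal_point n d t)"
proof -
  define e where "e = minimal_point n d t"
  define r where "r = excess n d t"
  have e: "(n + 1 - d) * e = t * (n - 2) + 2 + r"
    by (simp add: e_def r_def minimal_point_mult)
  obtain b where b: "0 \<le> b" "b \<le> d - 3" "b \<le> r" "r - b < n - d"
    and dvd: "d dvd b - 2 * (t - 1)"
    using assms(1) unfolding accessible_level_def r_def by blast
  have "t * (d - 2) + 2 + b = (b - 2 * (t - 1)) + d * t"
    by (simp add: algebra_simps)
  with dvd have "d dvd t * (d - 2) + 2 + b" by (metis dvd_add dvd_triv_left)
  then obtain e0 where e0: "d * e0 = t * (d - 2) + 2 + b"
    by (metis dvdE)
  have left: "\<lfloor>real_of_int (- d * e0 + e) / real_of_int (n - d)\<rfloor> = t - e"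
  proof (rule floor_divide_eqI)
    have "- d * e0 + e - (n - d) * (t - e) = r - b"
      using e e0 by (simp add: algebra_simps)
    then show "(n - d) * (t - e) \<le> - d * e0 + e" "- d * e0 + e < (n - d) * (t - e) + (n - d)"
      using b by linarith+
  qed (use dn in simp)
  have right: "\<lfloor>real_of_int (2 * e0 - 2) / real_of_int (d - 2)\<rfloor> = t - e0"
  proof (rule floor_divide_eqI)
    have "2 * e0 - 2 - (d - 2) * (t - e0) = b"
      using e0 by (simp add: algebra_simps)
    then show "(d - 2) * (t - e0) \<le> 2 * e0 - 2" "2 * e0 - 2 < (d - 2) * (t - e0) + (d - 2)"
      using b by linarith+
  qed (use d in simp)
  have "d * (d - 1) \<le> d * e0"
  proof -
    have "t * 1 \<le> t * (d - 2)"
      using large d dn by (intro mult_left_mono) (auto intro: order_trans[of 0 "d * d + n"])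
    moreover have "d * (d - 1) \<le> d * d" using d by simp
    ultimately show ?thesis using e0 b large d dn by linarith
  qed
  then have lower: "d - 1 \<le> e0" using d by simp
  have "e0 \<le> t"
  proof -
    have "0 \<le> t" using large d dn by (auto intro: order_trans[of 0 "d * d + n"])
    have "d * e0 \<le> d * t + (d - 1) - 2 * t"
      using e0 b by (simp add: algebra_simps)
    also have "\<dots> \<le> d * t"
    proof -
      have "1 * d \<le> d * d" using d by (intro mult_right_mono) auto
      then show ?thesis using large d dn by linarith
    qed
    finally show ?thesis using d by simp
  qed
  moreover have "t \<le> e"
  proof -
    have "0 \<le> t" using large d dn by (auto intro: order_trans[of 0 "d * d + n"])
    then have "(n + 1 - d) * t \<le> (n - 2) * t"
      using d by (intro mult_right_mono) auto
    also have "\<dots> \<le> (n + 1 - d) * e"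
      using e b by (simp add: mult.commute)
    finally show ?thesis using dn by simp
  qed
  ultimately show ?thesis
    using left right lower unfolding accessible_def e_def[symmetric]
    by (intro exI[of _ e0]) linarith
qed

text \<open>Since \<open>t\<close> and \<open>minimal_point n d t\<close> determine each other and increase together by
  \<open>d m\<close> and \<open>d (n-2)\<close>, a single count of levels serves both the points and the values of \<open>q\<close>.\<close>
lemma ray_classes_from_levels:
  fixes \<tau> :: "'a \<Rightarrow> int"
  assumes fin: "finite I" and c: "c \<le> real (card I)"
    and inc: "\<And>i j. i \<in> I \<Longrightarrow> j \<in> I \<Longrightarrow> [\<tau> i = \<tau> j] (mod d * (n + 1 - d)) \<Longrightarrow> i = j"
    and lev: "\<And>i. i \<in> I \<Longrightarrow> accessible_level n d (\<tau> i)"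
  shows "contains_ray_classes {e. accessible n d e \<and> point_minimal n d e} (d * (n - 2)) c"
    and "contains_ray_classes (q n d ` {e. accessible n d e \<and> point_minimal n d e})
           (d * (n + 1 - d)) c"
proof -
  let ?S = "{e. accessible n d e \<and> point_minimal n d e}"
  let ?T = "d * d + n"
  have S: "minimal_point n d t \<in> ?S"
    if "i \<in> I" "[t = \<tau> i] (mod d * (n + 1 - d))" "?T \<le> t" for t i
    using that accessible_minimal_point[of t] point_minimal_minimal_point[of t]
      accessible_level_cong[of "\<tau> i" t d n] lev by (auto simp: cong_sym)
  have shift: "\<exists>k. x = minimal_point n d (t + d * (n + 1 - d) * k)"
    if "[x = minimal_point n d t] (mod d * (n - 2))" for x t
    using that minimal_point_add[OF dn] by (metis cong_iff_lin cong_sym)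
  show "contains_ray_classes ?S (d * (n - 2)) c"
  proof (rule contains_ray_classesI[OF fin _ _ _ c,
        where g = "\<lambda>i. minimal_point n d (\<tau> i)" and B = "minimal_point n d ?T"])
    fix i j
    assume ij: "i \<in> I" "j \<in> I"
      and "[minimal_point n d (\<tau> i) = minimal_point n d (\<tau> j)] (mod d * (n - 2))"
    then obtain k where
      "minimal_point n d (\<tau> i) = minimal_point n d (\<tau> j + d * (n + 1 - d) * k)"
      using shift by blast
    then have "\<tau> i = \<tau> j + d * (n + 1 - d) * k"
      using minimal_point_le_iff by (metis order_antisym order_refl)
    then show "i = j" using inc[OF ij] by (simp add: cong_def)
  next
    fix i x
    assume i: "i \<in> I" and "[x = minimal_point n d (\<tau> i)] (mod d * (n - 2))"
      and B: "minimal_point n d ?T \<le> x"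
    then obtain k where x: "x = minimal_point n d (\<tau> i + d * (n + 1 - d) * k)"
      using shift by blast
    show "x \<in> ?S"
      unfolding x using B i by (intro S[OF i]) (auto simp: x minimal_point_le_iff cong_def)
  qed (use d dn in simp)
  show "contains_ray_classes (q n d ` ?S) (d * (n + 1 - d)) c"
  proof (rule contains_ray_classesI[OF fin _ _ _ c,
        where g = "\<lambda>i. \<tau> i + 1" and B = "?T + 1"])
    fix i j
    assume "i \<in> I" "j \<in> I" "[\<tau> i + 1 = \<tau> j + 1] (mod d * (n + 1 - d))"
    then show "i = j" using inc by (simp add: cong_add_rcancel)
  next
    fix i x
    assume i: "i \<in> I" and "[x = \<tau> i + 1] (mod d * (n + 1 - d))" and x: "?T + 1 \<le> x"
    then have "[(x - 1) + 1 = \<tau> i + 1] (mod d * (n + 1 - d))" by simp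
    then have "[x - 1 = \<tau> i] (mod d * (n + 1 - d))"
      by (simp only: cong_add_rcancel)
    then have "minimal_point n d (x - 1) \<in> ?S"
      using S[OF i] x by simp
    then show "x \<in> q n d ` ?S"
      by (rule rev_image_eqI) (simp add: q_minimal_point)
  qed (use d dn in simp)
qed

section \<open>Half of the residues, without coprimality\<close>

text \<open>If \<open>r = m - 1\<close> for both \<open>t\<close> and \<open>t + d\<close>, then \<open>m\<close> divides \<open>d (d-3)\<close>. For
  \<open>t = 1 + d i\<close> it then divides \<open>d - 2\<close>, hence also \<open>(d-2) (d-1) - d (d-3) = 2\<close>, whereas
  \<open>m \<ge> 3\<close>.\<close>
lemma excess_not_maximal_twice:
  assumes "excess n d (1 + d * i) = n - d"
  shows "excess n d (1 + d * (i + 1)) \<noteq> n - d"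
proof
  let ?m = "n + 1 - d"
  have *: "?m dvd d * (d - 3) * i + (d - 2)" if "excess n d (1 + d * i) = n - d" for i
  proof -
    have "[- 2 - (1 + d * i) * (d - 3) = n - d] (mod ?m)"
      using that dn by (simp add: excess_def cong_def)
    then have "?m dvd (- 2 - (1 + d * i) * (d - 3)) - (n - d)"
      by (simp add: cong_iff_dvd_diff)
    also have "(- 2 - (1 + d * i) * (d - 3)) - (n - d)
        = - (d * (d - 3) * i + (d - 2)) - ?m * 1"
      by (simp add: algebra_simps)
    finally show ?thesis
      using dvd_diff_right_iff by (metis dvd_minus_iff dvd_triv_left diff_add_cancel dvd_add)
  qed
  assume "excess n d (1 + d * (i + 1)) = n - d"
  from dvd_diff[OF *[OF this] *[OF assms]]
  have dd: "?m dvd d * (d - 3)" by (simp add: algebra_simps)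
  then have "?m dvd d - 2"
    using *[OF assms] by (metis dvd_add_right_iff dvd_mult2)
  then have "?m dvd (d - 2) * (d - 1) - d * (d - 3)"
    using dd by (intro dvd_diff) auto
  also have "(d - 2) * (d - 1) - d * (d - 3) = 2" by (simp add: algebra_simps)
  finally have "?m \<le> 2" by (rule zdvd_imp_le) simp
  then show False using dn by simp
qed

lemma card_excess_not_maximal:
  "real_of_int (n + 1 - d) / 2 \<le> real (card ({0..<n + 1 - d} - {i. excess n d (1 + d * i) = n - d}))"
    (is "_ \<le> real (card ?G)")
proof -
  let ?m = "n + 1 - d"
  define E where "E = {0..<?m} \<inter> {i. excess n d (1 + d * i) = n - d}"
  have wrap: "excess n d (1 + d * (j mod ?m)) = excess n d (1 + d * j)" for j
  proof -
    have "1 + d * j = 1 + d * (j mod ?m + ?m * (j div ?m))" by simp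
    also have "\<dots> = (1 + d * (j mod ?m)) + d * ?m * (j div ?m)"
      by (simp only: distrib_left mult.assoc add.assoc)
    finally show ?thesis by (metis excess_add)
  qed
  \<comment> \<open>Cyclic succession maps the bad residues injectively into the good ones.\<close>
  have "(\<lambda>i. (i + 1) mod ?m) ` E \<subseteq> ?G"
    using excess_not_maximal_twice dn by (auto simp: E_def wrap)
  moreover have "inj_on (\<lambda>i. (i + 1) mod ?m) E"
  proof (rule inj_onI)
    fix i j assume ij: "i \<in> E" "j \<in> E" and "(i + 1) mod ?m = (j + 1) mod ?m"
    then have "[i = j] (mod ?m)" by (metis cong_add_rcancel cong_def)
    then show "i = j" using ij by (simp add: E_def cong_def)
  qed
  ultimately have "card E \<le> card ?G"
    by (intro card_inj_on_le) simp_all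
  moreover have "card {0..<?m} = card E + card ?G"
    unfolding E_def by (rule card_Int_Diff) simp
  ultimately have "?m \<le> int (2 * card ?G)"
    by simp
  then have "real_of_int ?m \<le> real_of_int (int (2 * card ?G))"
    by (simp only: of_int_le_iff)
  then show ?thesis by (simp del: of_int_diff of_int_add)
qed

section \<open>A triangle of residues in the coprime case\<close>

text \<open>Doubling mod \<open>d\<close> is a bijection for odd \<open>d\<close>, and two-to-one onto the even residues for even
  \<open>d\<close>. In both cases the residues \<open>u\<close> for which \<open>2 u mod d\<close> is at most \<open>x\<close> number at least
  \<open>x + 1\<close>; \<open>half_mod j\<close> enumerates them, with \<open>2 u mod d\<close> equal to \<open>j\<close> or \<open>j - 1\<close>.\<close>
definition half_mod :: "int \<Rightarrow> int" where
  "half_mod j = (if even j then j div 2 else (j + d) div 2)"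

lemma half_mod_bounds:
  assumes "0 \<le> j" "j < d"
  shows "0 \<le> half_mod j" "half_mod j < d"
  using assms unfolding half_mod_def by presburger+

lemma half_mod_inj:
  assumes "0 \<le> i" "i < d" "0 \<le> j" "j < d" "half_mod i = half_mod j"
  shows "i = j"
  using assms unfolding half_mod_def by (auto split: if_splits; presburger)

lemma half_mod_double:
  assumes "0 \<le> j"
  shows "\<exists>b. 0 \<le> b \<and> b \<le> j \<and> d dvd b - 2 * half_mod j"
proof -
  consider "even j" | "odd j" "odd d" | "odd j" "even d" by blast
  then show ?thesis
  proof cases
    case 1
    then show ?thesis using assms by (intro exI[of _ j]) (auto simp: half_mod_def)
  next
    case 2
    then have "2 * half_mod j = j + d" by (simp add: half_mod_def)
    then show ?thesis using assms by (intro exI[of _ j]) auto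
  next
    case 3
    then have "2 * half_mod j = j - 1 + d" "j \<noteq> 0"
      unfolding half_mod_def by presburger+
    then show ?thesis using assms by (intro exI[of _ "j - 1"]) auto
  qed
qed

text \<open>Both factors of \<open>(n+1) (n-2)\<close> enter: mod \<open>m\<close> they are \<open>d\<close>, which makes \<open>t\<close> mod \<open>d\<close> and
  \<open>t\<close> mod \<open>m\<close> independent, and \<open>d - 3\<close>, which makes \<open>excess\<close> a bijective function of
  \<open>t\<close> mod \<open>m\<close>.\<close>
lemma level_with_residue_and_excess:
  assumes "gcd ((n + 1) * (n - 2)) (n + 1 - d) = 1" and "0 \<le> r" "r \<le> n - d"
  shows "\<exists>t. [t = u + 1] (mod d) \<and> excess n d t = r"
proof -
  let ?m = "n + 1 - d"
  have cop: "coprime (n + 1) ?m" "coprime (n - 2) ?m"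
    using assms(1) by (simp_all add: coprime_iff_gcd_eq_1[symmetric])
  have "gcd d ?m = gcd (n + 1) ?m"
    using gcd_add_mult[of ?m 1 d] by (simp add: gcd.commute)
  then have cd: "coprime d ?m" using cop(1) by (simp add: coprime_iff_gcd_eq_1)
  have "gcd (d - 3) ?m = gcd (n - 2) ?m"
    using gcd_add_mult[of ?m 1 "d - 3"] by (simp add: gcd.commute)
  then have "coprime (d - 3) ?m" using cop(2) by (simp add: coprime_iff_gcd_eq_1)
  then obtain x where x: "[(d - 3) * x = 1] (mod ?m)"
    using cong_solve_coprime_int by blast
  obtain t where t: "[t = u + 1] (mod d)" "[t = x * (- 2 - r)] (mod ?m)"
    using binary_chinese_remainder_int[OF cd] by blast
  have "[t * (d - 3) = x * (- 2 - r) * (d - 3)] (mod ?m)"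
    using t(2) by (rule cong_scalar_right)
  also have "x * (- 2 - r) * (d - 3) = (d - 3) * x * (- 2 - r)" by simp
  also have "[\<dots> = 1 * (- 2 - r)] (mod ?m)"
    using x by (rule cong_scalar_right)
  finally have "[- 2 - t * (d - 3) = - 2 - 1 * (- 2 - r)] (mod ?m)"
    by (intro cong_diff cong_refl)
  then have "excess n d t = r"
    using assms(2,3) by (simp add: excess_def cong_def)
  then show ?thesis using t(1) by blast
qed

lemma card_triangle:
  "real (card (SIGMA r:{0..<int k}. {0..r})) = real k * (real k + 1) / 2"
proof (induction k)
  case (Suc k)
  have "(SIGMA r:{0..<int (Suc k)}. {0..r})
      = (SIGMA r:{0..<int k}. {0..r}) \<union> {int k} \<times> {0..int k}" (is "_ = ?A \<union> ?B")
    by auto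
  moreover have "card (?A \<union> ?B) = card ?A + card ?B"
    by (intro card_Un_disjoint) auto
  ultimately show ?case
    using Suc by (simp add: card_cartesian_product field_simps)
qed simp

lemma f_le_triangle:
  assumes "k = nat (min (n - d) (d - 2))"
  shows "f n d \<le> real k * (real k + 1) / 2"
proof (cases "n - d \<le> d - 2")
  case True
  then have k: "real k = real_of_int (n - d)" using assms dn by simp
  have "f n d \<le> real_of_int ((n - d) * (n - d - 1)) / 2 - 2"
    unfolding f_def by (intro Min_le) auto
  also have "real_of_int ((n - d) * (n - d - 1)) = real k * (real k - 1)"
    by (simp add: k)
  also have "real k * (real k - 1) / 2 - 2 \<le> real k * (real k + 1) / 2"
    by (simp add: field_simps)
  finally show ?thesis .
next
  case False
  then have k: "real k = real_of_int (d - 2)" using assms d by simp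
  have "f n d \<le> real_of_int ((d + 1) * (d - 6)) / 2"
    unfolding f_def by (intro Min_le) auto
  also have "real_of_int ((d + 1) * (d - 6)) = (real k + 3) * (real k - 4)"
    by (simp add: k)
  also have "(real k + 3) * (real k - 4) / 2 \<le> real k * (real k + 1) / 2"
    by (simp add: field_simps)
  finally show ?thesis .
qed

text \<open>Restricting to \<open>r < m - 1\<close> makes every \<open>b \<in> [0, r]\<close> admissible, and \<open>r < d - 2\<close> keeps
  \<open>b \<le> d - 3\<close>.\<close>
lemma coprime_levels:
  assumes "gcd ((n + 1) * (n - 2)) (n + 1 - d) = 1"
  obtains I :: "(int \<times> int) set" and \<tau> where "finite I" and "f n d \<le> real (card I)"
    and "\<And>i j. i \<in> I \<Longrightarrow> j \<in> I \<Longrightarrow> [\<tau> i = \<tau> j] (mod d * (n + 1 - d)) \<Longrightarrow> i = j"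
    and "\<And>i. i \<in> I \<Longrightarrow> accessible_level n d (\<tau> i)"
proof -
  define k where "k = nat (min (n - d) (d - 2))"
  define I where "I = (SIGMA r:{0..<int k}. {0..r})"
  have I: "0 \<le> j" "j \<le> r" "r < n - d" "r < d - 2" if "(r, j) \<in> I" for r j
    using that d dn by (auto simp: I_def k_def)
  have "\<forall>p\<in>I. \<exists>t. [t = half_mod (snd p) + 1] (mod d) \<and> excess n d t = fst p"
  proof
    fix p assume "p \<in> I"
    then have "0 \<le> fst p" "fst p \<le> n - d"
      using I[of "fst p" "snd p"] by simp_all
    then show "\<exists>t. [t = half_mod (snd p) + 1] (mod d) \<and> excess n d t = fst p"
      by (rule level_with_residue_and_excess[OF assms])
  qed
  from bchoice[OF this] obtain \<tau> where
    "\<forall>p\<in>I. [\<tau> p = half_mod (snd p) + 1] (mod d) \<and> excess n d (\<tau> p) = fst p" ..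
  then have \<tau>: "[\<tau> (r, j) = half_mod j + 1] (mod d)" "excess n d (\<tau> (r, j)) = r"
    if "(r, j) \<in> I" for r j
    using that by auto
  have inc: "(r, j) = (r', j')"
    if p: "(r, j) \<in> I" "(r', j') \<in> I" "[\<tau> (r, j) = \<tau> (r', j')] (mod d * (n + 1 - d))"
    for r j r' j'
  proof -
    obtain c where c: "\<tau> (r', j') = \<tau> (r, j) + d * (n + 1 - d) * c"
      using p(3) by (metis cong_iff_lin)
    then have "r = r'" using \<tau>(2)[OF p(1)] \<tau>(2)[OF p(2)] excess_add by metis
    have "[\<tau> (r, j) = \<tau> (r', j')] (mod d)"
      using p(3) by (rule cong_modulus_mult)
    then have "[half_mod j + 1 = half_mod j' + 1] (mod d)"
      using \<tau>(1)[OF p(1)] \<tau>(1)[OF p(2)] by (meson cong_sym cong_trans)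
    then have "[half_mod j = half_mod j'] (mod d)" by (simp only: cong_add_rcancel)
    moreover have *: "0 \<le> j" "j < d" "0 \<le> j'" "j' < d" using I[OF p(1)] I[OF p(2)] by auto
    ultimately have "half_mod j = half_mod j'"
      using half_mod_bounds[of j] half_mod_bounds[of j'] by (simp add: cong_def)
    then have "j = j'" using half_mod_inj * by blast
    with \<open>r = r'\<close> show ?thesis by simp
  qed
  have lev: "accessible_level n d (\<tau> (r, j))" if p: "(r, j) \<in> I" for r j
  proof -
    obtain b where b: "0 \<le> b" "b \<le> j" "d dvd b - 2 * half_mod j"
      using half_mod_double I(1)[OF p] by blast
    have "d dvd \<tau> (r, j) - (half_mod j + 1)"
      using \<tau>(1)[OF p] by (simp add: cong_iff_dvd_diff)
    then have "d dvd (b - 2 * half_mod j) - 2 * (\<tau> (r, j) - (half_mod j + 1))"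
      by (rule dvd_diff[OF b(3) dvd_mult])
    also have "\<dots> = b - 2 * (\<tau> (r, j) - 1)" by simp
    finally show ?thesis
      unfolding accessible_level_def using b I[OF p] \<tau>(2)[OF p]
      by (intro exI[of _ b]) auto
  qed
  have fin: "finite I" by (simp add: I_def)
  have card: "f n d \<le> real (card I)"
    unfolding I_def card_triangle by (rule f_le_triangle) (rule k_def)
  show thesis
  proof (rule that[OF fin card])
    fix i j assume "i \<in> I" "j \<in> I" "[\<tau> i = \<tau> j] (mod d * (n + 1 - d))"
    then show "i = j"
      using inc[of "fst i" "snd i" "fst j" "snd j"] by simp
  next
    fix i assume "i \<in> I"
    then show "accessible_level n d (\<tau> i)"
      using lev[of "fst i" "snd i"] by simp
  qed
qed

end

section \<open>Ray classes of accessible point-minimal integers\<close>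

theorem theoremA2:
  fixes n d :: int
  assumes "3 < d" and "d < n - 1"
  shows
    "contains_ray_classes {e. accessible n d e \<and> point_minimal n d e}
       (d * (n - 2)) (real_of_int (n + 1 - d) / 2) \<and>
     contains_ray_classes (q n d ` {e. accessible n d e \<and> point_minimal n d e})
       ((n + 1 - d) * d) (real_of_int (n + 1 - d) / 2) \<and>
     (gcd ((n + 1) * (n - 2)) (n + 1 - d) = 1 \<longrightarrow>
       contains_ray_classes {e. accessible n d e \<and> point_minimal n d e}
         (d * (n - 2)) (f n d) \<and>
       contains_ray_classes (q n d ` {e. accessible n d e \<and> point_minimal n d e})
         (d * (n + 1 - d)) (f n d))"
proof -
  define G where "G = {0..<n + 1 - d} - {i. excess n d (1 + d * i) = n - d}"
  have fin: "finite G" by (simp add: G_def)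
  have card: "real_of_int (n + 1 - d) / 2 \<le> real (card G)"
    unfolding G_def by (rule card_excess_not_maximal[OF assms])
  have inc: "i = j"
    if "i \<in> G" "j \<in> G" "[1 + d * i = 1 + d * j] (mod d * (n + 1 - d))" for i j
  proof -
    have "d * (n + 1 - d) dvd d * (i - j)"
      using that(3) by (simp add: cong_iff_dvd_diff right_diff_distrib)
    then have "[i = j] (mod n + 1 - d)"
      using assms by (simp add: cong_iff_dvd_diff)
    then show ?thesis using that by (simp add: G_def cong_def)
  qed
  have lev: "accessible_level n d (1 + d * i)" if "i \<in> G" for i
  proof -
    have "excess n d (1 + d * i) \<noteq> n - d" using that by (simp add: G_def)
    then have "excess n d (1 + d * i) - 0 < n - d"
      using excess_bounds(2)[OF assms, of "1 + d * i"] by linarith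
    moreover have "d dvd 0 - 2 * (1 + d * i - 1)" by simp
    ultimately show ?thesis
      unfolding accessible_level_def
      using excess_bounds(1)[OF assms, of "1 + d * i"] assms(1) by (intro exI[of _ 0]) linarith
  qed
  have half:
    "contains_ray_classes {e. accessible n d e \<and> point_minimal n d e}
       (d * (n - 2)) (real_of_int (n + 1 - d) / 2)"
    "contains_ray_classes (q n d ` {e. accessible n d e \<and> point_minimal n d e})
       (d * (n + 1 - d)) (real_of_int (n + 1 - d) / 2)"
    by (rule ray_classes_from_levels[where \<tau> = "\<lambda>i. 1 + d * i", OF assms fin card];
        (fact inc | fact lev))+
  have "contains_ray_classes {e. accessible n d e \<and> point_minimal n d e} (d * (n - 2)) (f n d) \<and>
    contains_ray_classes (q n d ` {e. accessible n d e \<and> point_minimal n d e})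
      (d * (n + 1 - d)) (f n d)"
    if gcd: "gcd ((n + 1) * (n - 2)) (n + 1 - d) = 1"
  proof (rule coprime_levels[OF assms gcd])
    fix I :: "(int \<times> int) set" and \<tau>
    assume I: "finite I" "f n d \<le> real (card I)"
      and inj: "\<And>i j. i \<in> I \<Longrightarrow> j \<in> I \<Longrightarrow> [\<tau> i = \<tau> j] (mod d * (n + 1 - d)) \<Longrightarrow> i = j"
      and acc: "\<And>i. i \<in> I \<Longrightarrow> accessible_level n d (\<tau> i)"
    show ?thesis
      by (rule conjI; rule ray_classes_from_levels[where \<tau> = \<tau>, OF assms I];
          (fact inj | fact acc))
  qed
  then show ?thesis
    using half by (subst mult.commute[of "n + 1 - d" d]) (intro conjI impI; blast)
qed

end
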